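(* There exist random variables $S, X$ with finite alphabets (jointly distributed on a common probability space) and a function $f:\mathcal{S}\to\mathcal{S}'$ from the support $\mathcal{S}$ of $S$ to a finite set $\mathcal{S}'$ such that $$(X\leftarrow f(S))\cdot(f(S)\leftarrow S)\;\not\preceq\;(X\leftarrow S).$$
   Context: A channel with finite input alphabet $\mathcal{I}$ and finite output alphabet $\mathcal{O}$ is a column-stochastic matrix $\kappa=(\kappa_{x,s})_{x\in\mathcal{O},s\in\mathcal{I}}$, that is, it has nonnegative entries and $\sum_{x}\kappa_{x,s}=1$ for every $s\in\mathcal{I}$. The product of channels (composition) is matrix multiplication. For two channels $\kappa_1,\kappa_2$ with the same input alphabet (and possibly different output alphabets), write $\kappa_1\preceq\kappa_2$ (Blackwell order) if there is a column-stochastic matrix $\lambda$ with $\kappa_1=\lambda\cdot\kappa_2$ (i.e. $\kappa_1$ is a garbling of $\kappa_2$). For jointly distributed finite-valued random variables $T, X$, the notation $X\leftarrow T$ denotes the channel whose input alphabet is the support of $T$ (the set of values $t$ with $\Pr(T=t)>0$), whose output alphabet is that of $X$, and whose entries are the conditional probabilities $P_{X|T}(x|t)$. Thus $(X\leftarrow f(S))\cdot(f(S)\leftarrow S)$ is the channel with input alphabet $\mathcal{S}$ and entries $\sum_{t}P_{X|f(S)}(x|t)\,P_{f(S)|S}(t|s)=P_{X|f(S)}(x|f(s))$. *)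

theory Defs
  imports "HOL-Probability.Probability"
begin

text \<open>Matrices indexed by arbitrary sets. Values of \<open>entry\<close> outside \<open>row_set \<times> col_set\<close> carry no meaning.\<close>

record ('x, 's) indexed_matrix =
  row_set :: "'x set"
  col_set :: "'s set"
  entry :: "'x \<Rightarrow> 's \<Rightarrow> real"

definition matrix_eq :: "('x, 's) indexed_matrix \<Rightarrow> ('x, 's) indexed_matrix \<Rightarrow> bool" (infix "\<doteq>" 50) where
  "A \<doteq> B \<longleftrightarrow> row_set A = row_set B \<and> col_set A = col_set B \<and>
     (\<forall>x\<in>row_set A. \<forall>s\<in>col_set A. entry A x s = entry B x s)"

text \<open>The product is meant for \<open>row_set B = col_set A\<close>.\<close>

definition matrix_prod ::
    "('x, 't) indexed_matrix \<Rightarrow> ('t, 's) indexed_matrix \<Rightarrow> ('x, 's) indexed_matrix" (infixl "\<odot>" 70) where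
  "A \<odot> B = \<lparr>row_set = row_set A, col_set = col_set B,
     entry = (\<lambda>x s. \<Sum>t\<in>col_set A. entry A x t * entry B t s)\<rparr>"

text \<open>Rows are indexed by the output alphabet and columns by the input alphabet.\<close>

definition channel :: "('x, 's) indexed_matrix \<Rightarrow> bool" where
  "channel \<kappa> \<longleftrightarrow> finite (row_set \<kappa>) \<and> finite (col_set \<kappa>) \<and>
     (\<forall>x\<in>row_set \<kappa>. \<forall>s\<in>col_set \<kappa>. entry \<kappa> x s \<ge> 0) \<and>
     (\<forall>s\<in>col_set \<kappa>. (\<Sum>x\<in>row_set \<kappa>. entry \<kappa> x s) = 1)"

definition blackwell_le :: "('x, 's) indexed_matrix \<Rightarrow> ('y, 's) indexed_matrix \<Rightarrow> bool" (infix "\<preceq>" 50) where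
  "\<kappa>1 \<preceq> \<kappa>2 \<longleftrightarrow> (\<exists>\<Lambda>. channel \<Lambda> \<and> col_set \<Lambda> = row_set \<kappa>2 \<and> \<kappa>1 \<doteq> \<Lambda> \<odot> \<kappa>2)"

definition rv_support :: "'w measure \<Rightarrow> ('w \<Rightarrow> 't) \<Rightarrow> 't set" where
  "rv_support M T = {t. \<P>(\<omega> in M. T \<omega> = t) > 0}"

text \<open>\<open>cond_channel M AX X T\<close> is the channel \<open>X \<leftarrow> T\<close>, where \<open>AX\<close> is the alphabet of \<open>X\<close>.\<close>

definition cond_channel ::
    "'w measure \<Rightarrow> 'x set \<Rightarrow> ('w \<Rightarrow> 'x) \<Rightarrow> ('w \<Rightarrow> 't) \<Rightarrow> ('x, 't) indexed_matrix" where
  "cond_channel M AX X T = \<lparr>row_set = AX, col_set = rv_support M T,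
     entry = (\<lambda>x t. \<P>(\<omega> in M. X \<omega> = x \<bar> T \<omega> = t))\<rparr>"

text \<open>The channels above are column-stochastic, and \<open>X \<leftarrow> f(S)\<close>, \<open>f(S) \<leftarrow> S\<close> are composable when \<open>f(S)\<close> is
  given the alphabet \<open>f ` rv_support M S\<close>.
  On a null set \<open>f(S)\<close> may leave that alphabet, hence the hypothesis on \<open>rv_support M X\<close> below.\<close>

lemma rv_support_subset:
  assumes "T \<in> measurable M (count_space A)"
  shows "rv_support M T \<subseteq> A"
proof
  fix t assume t: "t \<in> rv_support M T"
  have "{\<omega> \<in> space M. T \<omega> = t} \<noteq> {}"
    using t by (metis (mono_tags, lifting) less_irrefl measure_empty mem_Collect_eq rv_support_def)
  then show "t \<in> A"
    using measurable_space[OF assms] by auto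
qed

lemma channel_cond_channel_aux:
  assumes "prob_space M" and X: "X \<in> measurable M (count_space AX)" and "finite AX"
    and T: "T \<in> measurable M (count_space UNIV)" and "finite (rv_support M T)"
  shows "channel (cond_channel M AX X T)"
proof -
  interpret prob_space M by fact
  have "(\<Sum>x\<in>AX. \<P>(\<omega> in M. X \<omega> = x \<bar> T \<omega> = t)) = 1" if t: "t \<in> rv_support M T" for t
  proof -
    have pos: "\<P>(\<omega> in M. T \<omega> = t) > 0"
      using t by (simp add: rv_support_def)
    have [measurable]: "X \<in> measurable M (count_space AX)" "T \<in> measurable M (count_space UNIV)"
      using X T by auto
    have meas: "{\<omega> \<in> space M. X \<omega> = x \<and> T \<omega> = t} \<in> sets M" if "x \<in> AX" for x
    proof -
      have "X -` {x} \<inter> space M \<in> sets M" "T -` {t} \<inter> space M \<in> sets M"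
        using that by (auto intro!: measurable_sets[OF X] measurable_sets[OF T])
      then have "(X -` {x} \<inter> space M) \<inter> (T -` {t} \<inter> space M) \<in> sets M" by blast
      also have "(X -` {x} \<inter> space M) \<inter> (T -` {t} \<inter> space M) = {\<omega> \<in> space M. X \<omega> = x \<and> T \<omega> = t}"
        by auto
      finally show ?thesis .
    qed
    have "(\<Sum>x\<in>AX. \<P>(\<omega> in M. X \<omega> = x \<and> T \<omega> = t)) =
        prob (\<Union>x\<in>AX. {\<omega> \<in> space M. X \<omega> = x \<and> T \<omega> = t})"
      by (rule finite_measure_finite_Union[symmetric])
        (use meas \<open>finite AX\<close> in \<open>auto simp: disjoint_family_on_def\<close>)
    also have "(\<Union>x\<in>AX. {\<omega> \<in> space M. X \<omega> = x \<and> T \<omega> = t}) = {\<omega> \<in> space M. T \<omega> = t}"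
      using measurable_space[OF X] by auto
    finally show ?thesis
      using pos by (simp add: cond_prob_def flip: sum_divide_distrib)
  qed
  then show ?thesis
    using assms by (auto simp: channel_def cond_channel_def cond_prob_def)
qed

lemma channel_cond_channel:
  assumes "prob_space M" and X: "X \<in> measurable M (count_space B)" and "finite B"
    and AX: "rv_support M X \<subseteq> AX" "finite AX"
    and T: "T \<in> measurable M (count_space UNIV)" and "finite (rv_support M T)"
  shows "channel (cond_channel M AX X T)"
proof -
  interpret prob_space M by fact
  have zero: "\<P>(\<omega> in M. X \<omega> = x \<bar> T \<omega> = t) = 0" if "x \<notin> rv_support M X \<or> x \<notin> B" for x t
  proof (cases "x \<in> B")
    case True
    have "X -` {x} \<inter> space M \<in> sets M"
      using True by (auto intro!: measurable_sets[OF X])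
    also have "X -` {x} \<inter> space M = {\<omega> \<in> space M. X \<omega> = x}"
      by auto
    finally have "\<P>(\<omega> in M. X \<omega> = x \<and> T \<omega> = t) \<le> \<P>(\<omega> in M. X \<omega> = x)"
      by (intro finite_measure_mono) auto
    moreover have "\<P>(\<omega> in M. X \<omega> = x) \<le> 0"
      using that True by (simp add: rv_support_def)
    ultimately have "\<P>(\<omega> in M. X \<omega> = x \<and> T \<omega> = t) = 0"
      by (meson measure_nonneg order_antisym order_trans)
    then show ?thesis
      by (simp add: cond_prob_def)
  next
    case False
    then have empty: "{\<omega> \<in> space M. X \<omega> = x \<and> T \<omega> = t} = {}"
      using measurable_space[OF X] by auto
    show ?thesis
      unfolding cond_prob_def empty by simp
  qed
  have "(\<Sum>x\<in>AX. \<P>(\<omega> in M. X \<omega> = x \<bar> T \<omega> = t)) = (\<Sum>x\<in>B. \<P>(\<omega> in M. X \<omega> = x \<bar> T \<omega> = t))" for t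
    by (rule sum.mono_neutral_cong) (use assms zero in auto)
  moreover have "channel (cond_channel M B X T)"
    by (rule channel_cond_channel_aux) (use assms in auto)
  ultimately show ?thesis
    using AX by (auto simp: channel_def cond_channel_def cond_prob_def)
qed

lemma channel_matrix_prod:
  assumes A: "channel A" and B: "channel B" and "row_set B = col_set A"
  shows "channel (A \<odot> B)"
proof -
  have "(\<Sum>x\<in>row_set A. \<Sum>t\<in>col_set A. entry A x t * entry B t s) = 1" if s: "s \<in> col_set B" for s
  proof -
    have "(\<Sum>x\<in>row_set A. \<Sum>t\<in>col_set A. entry A x t * entry B t s) =
        (\<Sum>t\<in>col_set A. (\<Sum>x\<in>row_set A. entry A x t) * entry B t s)"
      by (subst sum.swap) (simp add: sum_distrib_right)
    also have "\<dots> = (\<Sum>t\<in>row_set B. entry B t s)"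
      using A assms(3) by (simp add: channel_def)
    finally show ?thesis using B s by (simp add: channel_def)
  qed
  then show ?thesis
    using assms by (auto simp: channel_def matrix_prod_def intro!: sum_nonneg mult_nonneg_nonneg)
qed

lemma rv_support_comp:
  assumes "prob_space M" and S: "S \<in> measurable M (count_space AS)" and "finite AS"
  shows "rv_support M (\<lambda>\<omega>. f (S \<omega>)) = f ` rv_support M S"
proof -
  interpret prob_space M by fact
  have meas: "{\<omega> \<in> space M. S \<omega> = s} \<in> sets M" if "s \<in> AS" for s
  proof -
    have "S -` {s} \<inter> space M \<in> sets M" using that by (auto intro!: measurable_sets[OF S])
    also have "S -` {s} \<inter> space M = {\<omega> \<in> space M. S \<omega> = s}" by auto
    finally show ?thesis .
  qed
  have eq: "\<P>(\<omega> in M. f (S \<omega>) = t) = (\<Sum>s\<in>{s\<in>AS. f s = t}. \<P>(\<omega> in M. S \<omega> = s))" for t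
  proof -
    have "(\<Sum>s\<in>{s\<in>AS. f s = t}. \<P>(\<omega> in M. S \<omega> = s)) =
       prob (\<Union>s\<in>{s\<in>AS. f s = t}. {\<omega> \<in> space M. S \<omega> = s})"
      by (rule finite_measure_finite_Union[symmetric])
        (use meas \<open>finite AS\<close> in \<open>auto simp: disjoint_family_on_def\<close>)
    also have "(\<Union>s\<in>{s\<in>AS. f s = t}. {\<omega> \<in> space M. S \<omega> = s}) = {\<omega> \<in> space M. f (S \<omega>) = t}"
      using measurable_space[OF S] by auto
    finally show ?thesis by simp
  qed
  show ?thesis
  proof (intro set_eqI iffI)
    fix t assume "t \<in> rv_support M (\<lambda>\<omega>. f (S \<omega>))"
    then have "(\<Sum>s\<in>{s\<in>AS. f s = t}. \<P>(\<omega> in M. S \<omega> = s)) > 0"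
      using eq by (simp add: rv_support_def)
    then obtain s where "s \<in> AS" "f s = t" "\<P>(\<omega> in M. S \<omega> = s) > 0"
      by (metis (mono_tags, lifting) mem_Collect_eq sum_nonpos not_less)
    then show "t \<in> f ` rv_support M S" by (auto simp: rv_support_def)
  next
    fix t assume "t \<in> f ` rv_support M S"
    then obtain s where s: "s \<in> rv_support M S" "t = f s" by auto
    then have "s \<in> AS" using rv_support_subset[OF S] by auto
    have "\<P>(\<omega> in M. S \<omega> = s) \<le> (\<Sum>s\<in>{s\<in>AS. f s = t}. \<P>(\<omega> in M. S \<omega> = s))"
      by (rule member_le_sum) (use s \<open>s \<in> AS\<close> \<open>finite AS\<close> in auto)
    then show "t \<in> rv_support M (\<lambda>\<omega>. f (S \<omega>))"
      using s eq by (auto simp: rv_support_def)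
  qed
qed

lemma composable_channels:
  fixes f :: "'b \<Rightarrow> 'c"
  assumes "prob_space M"
    and S: "S \<in> measurable M (count_space AS)" "finite AS"
    and X: "X \<in> measurable M (count_space AX)" "finite AX"
  defines "\<kappa>1 \<equiv> cond_channel M AX X (\<lambda>\<omega>. f (S \<omega>))"
    and "\<kappa>2 \<equiv> cond_channel M (f ` rv_support M S) (\<lambda>\<omega>. f (S \<omega>)) S"
  shows "channel \<kappa>1" "channel \<kappa>2" "row_set \<kappa>2 = col_set \<kappa>1"
    "channel (\<kappa>1 \<odot> \<kappa>2)" "channel (cond_channel M AX X S)"
proof -
  note supp = rv_support_comp[OF assms(1) S, of f]
  have fin: "finite (rv_support M S)"
    using rv_support_subset[OF S(1)] S(2) by (rule finite_subset)
  have S_UNIV: "S \<in> measurable M (count_space UNIV)"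
    by (rule measurable_compose[OF S(1), where g = "\<lambda>s. s"]) simp
  have f_AS: "(\<lambda>\<omega>. f (S \<omega>)) \<in> measurable M (count_space (f ` AS))"
    by (rule measurable_compose[OF S(1)]) simp
  have f_UNIV: "(\<lambda>\<omega>. f (S \<omega>)) \<in> measurable M (count_space UNIV)"
    by (rule measurable_compose[OF S(1)]) simp
  note X_supp = rv_support_subset[OF X(1)]
  show 1: "channel \<kappa>1"
    unfolding \<kappa>1_def
    by (rule channel_cond_channel[OF assms(1) X X_supp X(2) f_UNIV]) (simp add: supp fin)
  show 2: "channel \<kappa>2"
    unfolding \<kappa>2_def
    by (rule channel_cond_channel[OF assms(1) f_AS _ _ _ S_UNIV fin]) (simp_all add: supp fin S(2))
  show 3: "row_set \<kappa>2 = col_set \<kappa>1"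
    by (simp add: \<kappa>1_def \<kappa>2_def cond_channel_def supp)
  show "channel (\<kappa>1 \<odot> \<kappa>2)"
    using 1 2 3 by (rule channel_matrix_prod)
  show "channel (cond_channel M AX X S)"
    by (rule channel_cond_channel[OF assms(1) X X_supp X(2) S_UNIV fin])
qed

end

theory Submission
  imports Defs
begin

text \<open>Let \<open>S\<close> be uniform on \<open>{0, 1, 2}\<close>, \<open>X = S mod 2\<close> and \<open>f(s) = s div 2\<close>. The columns of \<open>X \<leftarrow> S\<close> at the
  inputs \<open>0\<close> and \<open>2\<close> coincide, so they coincide in every garbling of it. Since \<open>f\<close> merges \<open>0\<close> with
  \<open>1\<close> but not with \<open>2\<close>, the composed channel has entries \<open>1/2\<close> and \<open>1\<close> there.\<close>

text \<open>Each column of \<open>\<Lambda> \<odot> \<kappa>2\<close> is \<open>\<Lambda>\<close>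
  applied to the same column of \<open>\<kappa>2\<close>.\<close>

lemma garbling_columns_eq:
  assumes "\<kappa>1 \<preceq> \<kappa>2" and s: "s \<in> col_set \<kappa>1" "s' \<in> col_set \<kappa>1"
    and eq: "\<And>y. y \<in> row_set \<kappa>2 \<Longrightarrow> entry \<kappa>2 y s = entry \<kappa>2 y s'"
    and x: "x \<in> row_set \<kappa>1"
  shows "entry \<kappa>1 x s = entry \<kappa>1 x s'"
proof -
  obtain \<Lambda> where \<Lambda>: "col_set \<Lambda> = row_set \<kappa>2" "\<kappa>1 \<doteq> \<Lambda> \<odot> \<kappa>2"
    using assms(1) by (auto simp: blackwell_le_def)
  have "entry (\<Lambda> \<odot> \<kappa>2) x s = entry (\<Lambda> \<odot> \<kappa>2) x s'"
    using \<Lambda>(1) eq by (simp add: matrix_prod_def cong: sum.cong)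
  then show ?thesis
    using \<Lambda>(2) s x by (simp add: matrix_eq_def)
qed

text \<open>Writing the cardinality as a sum of indicators lets probabilities over an explicit
  finite set be evaluated point by point.\<close>

lemma prob_uniform_count_measure:
  assumes "finite A"
  shows "\<P>(\<omega> in uniform_count_measure A. Q \<omega>) = (\<Sum>\<omega>\<in>A. of_bool (Q \<omega>)) / real (card A)"
proof -
  have "A \<inter> {\<omega>. Q \<omega>} = {\<omega> \<in> A. Q \<omega>}" by auto
  then show ?thesis
    using assms by (simp add: space_uniform_count_measure measure_uniform_count_measure)
qed

theorem proposition3:
  "\<exists>(M :: nat measure) (S :: nat \<Rightarrow> nat) (X :: nat \<Rightarrow> nat) (AS :: nat set) (AX :: nat set)
     (f :: nat \<Rightarrow> nat) (S' :: nat set).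
     prob_space M \<and>
     finite AS \<and> S \<in> measurable M (count_space AS) \<and>
     finite AX \<and> X \<in> measurable M (count_space AX) \<and>
     finite S' \<and> f \<in> rv_support M S \<rightarrow> S' \<and>
     \<not> (cond_channel M AX X (\<lambda>\<omega>. f (S \<omega>)) \<odot>
          cond_channel M (f ` rv_support M S) (\<lambda>\<omega>. f (S \<omega>)) S
        \<preceq> cond_channel M AX X S)"
proof -
  define A :: "nat set" where "A = {0, 1, 2}"
  define M where "M = uniform_count_measure A"
  define S :: "nat \<Rightarrow> nat" where "S = (\<lambda>\<omega>. \<omega>)"
  define X :: "nat \<Rightarrow> nat" where "X = (\<lambda>\<omega>. \<omega> mod 2)"
  define f :: "nat \<Rightarrow> nat" where "f = (\<lambda>s. s div 2)"
  let ?P = "cond_channel M {0, 1} X (\<lambda>\<omega>. f (S \<omega>)) \<odot>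
          cond_channel M (f ` rv_support M S) (\<lambda>\<omega>. f (S \<omega>)) S"
  have M: "prob_space M"
    unfolding M_def A_def by (rule prob_space_uniform_count_measure) auto
  have S: "S \<in> measurable M (count_space A)"
    by (auto simp: measurable_def M_def S_def space_uniform_count_measure sets_uniform_count_measure)
  have X: "X \<in> measurable M (count_space {0, 1})"
    by (auto simp: measurable_def M_def X_def A_def space_uniform_count_measure sets_uniform_count_measure)
  have P: "\<P>(\<omega> in M. Q \<omega>) = (of_bool (Q 0) + of_bool (Q 1) + of_bool (Q 2)) / 3" for Q
    unfolding M_def A_def by (subst prob_uniform_count_measure) simp_all
  \<comment> \<open>Each point has mass 1/3. Hence 0 and 2 are genuine inputs of both channels, as
    the comparison of columns requires.\<close>
  have supp: "rv_support M S = A"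
  proof (rule antisym[OF rv_support_subset[OF S]])
    show "A \<subseteq> rv_support M S"
      unfolding rv_support_def P by (auto simp: A_def S_def)
  qed
  have supp_f: "rv_support M (\<lambda>\<omega>. f (S \<omega>)) = {0, 1}"
    using rv_support_comp[OF M S, of f] by (simp add: supp A_def f_def)
  have "\<not> ?P \<preceq> cond_channel M {0, 1} X S"
  proof
    assume "?P \<preceq> cond_channel M {0, 1} X S"
    then have eq: "entry ?P 0 0 = entry ?P 0 2"
    proof (rule garbling_columns_eq)
      fix y assume "y \<in> row_set (cond_channel M {0, 1} X S)"
      then show "entry (cond_channel M {0, 1} X S) y 0 = entry (cond_channel M {0, 1} X S) y 2"
        \<comment> \<open>Both inputs are even, so each of the two columns is the point mass at
          output 0.\<close>
        unfolding cond_channel_def cond_prob_def P by (auto simp: S_def X_def)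
    qed (auto simp: matrix_prod_def cond_channel_def supp A_def)
    have entry_P: "entry ?P 0 s = (\<Sum>t\<in>{0, 1}. \<P>(\<omega> in M. X \<omega> = 0 \<bar> f (S \<omega>) = t) *
        \<P>(\<omega> in M. f (S \<omega>) = t \<bar> S \<omega> = s))" for s
      by (simp add: matrix_prod_def cond_channel_def supp_f)
    \<comment> \<open>The event \<open>f (S \<omega>) = 0\<close> contains one even and one odd
      point, whence 1/2; \<open>f (S \<omega>) = 1\<close> contains only the even point 2. The
      remaining values are 0 or 1 because \<open>S\<close> determines \<open>f(S)\<close>, so each
      column of the product is a single column of the left factor.\<close>
    have vals: "\<P>(\<omega> in M. X \<omega> = 0 \<bar> f (S \<omega>) = 0) = 1 / 2"
      "\<P>(\<omega> in M. X \<omega> = 0 \<bar> f (S \<omega>) = 1) = 1"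
      "\<P>(\<omega> in M. f (S \<omega>) = 0 \<bar> S \<omega> = 0) = 1" "\<P>(\<omega> in M. f (S \<omega>) = 1 \<bar> S \<omega> = 0) = 0"
      "\<P>(\<omega> in M. f (S \<omega>) = 0 \<bar> S \<omega> = 2) = 0" "\<P>(\<omega> in M. f (S \<omega>) = 1 \<bar> S \<omega> = 2) = 1"
      unfolding cond_prob_def P by (simp_all add: S_def X_def f_def)
    have "entry ?P 0 0 = 1 / 2"
      unfolding entry_P by (simp add: vals[simplified])
    moreover have "entry ?P 0 2 = 1"
      unfolding entry_P by (simp add: vals[simplified])
    ultimately show False
      using eq by linarith
  qed
  moreover have "f \<in> rv_support M S \<rightarrow> {0, 1}"
    by (auto simp: supp A_def f_def)
  moreover have "finite A"
    by (simp add: A_def)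
  ultimately show ?thesis
    using M S X
    by (intro exI[of _ M] exI[of _ S] exI[of _ X] exI[of _ A] exI[of _ "{0, 1}"] exI[of _ f]) simp
qed

end
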